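(* Let $n\ge 3$. For every polytope $\mathrm{Ass}_n^{\rm II}(A_n)$ whose normal fan is the fan with maximal cones $\mathbb{R}_{\ge0}C$ generated by all clusters $C$ of type $A_n$, and every vector $\mathbf{a}=\{a_{ij}>0:1\le i\le j\le n+1\}$ of positive parameters, the polytopes $\mathrm{Ass}_n^{\rm II}(A_n)$ and $\mathrm{Ass}_n^{\rm III}(\mathbf{a})$ are not affinely equivalent.
   Context: Construction II. Let $\alpha_i=e_i-e_{i+1}$, $1\le i\le n$, be the simple roots of type $A_n$ in $\mathbb{R}^{n+1}$; the positive roots are $\alpha_{ij}=\alpha_i+\cdots+\alpha_j$, $1\le i\le j\le n$; the almost positive roots are the positive roots together with $-\alpha_1,\dots,-\alpha_n$. Label the vertices of a convex $(n+3)$-gon $1,\dots,n+3$ in cyclic order. Identify the almost positive roots with diagonals of the polygon: $-\alpha_{2i-1}$ with $\{i,n+3-i\}$ for $1\le i\le(n+1)/2$ and $-\alpha_{2i}$ with $\{i+1,n+3-i\}$ for $1\le i\le n/2$ (the zigzag "snake"), and $\alpha_{ij}$ with the unique diagonal crossing, among the snake diagonals, exactly $-\alpha_i,\dots,-\alpha_j$. Two almost positive roots are compatible if their diagonals do not cross; clusters are the maximal sets of pairwise compatible almost positive roots. The cones $\mathbb{R}_{\ge0}C$ over clusters $C$ form a complete simplicial fan in $V=\{x\in\mathbb{R}^{n+1}:x_1+\cdots+x_{n+1}=0\}$ (identified with its dual via the standard inner product), which is the normal fan of some $n$-dimensional simple polytope; $\mathrm{Ass}_n^{\rm II}(A_n)$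 denotes any polytope with this normal fan. Construction III. For $\mathbf{a}=\{a_{ij}>0:1\le i\le j\le n+1\}$, $\mathrm{Ass}_n^{\rm III}(\mathbf{a})=\sum_{1\le i\le j\le n+1}a_{ij}\Delta_{[i,\dots,j]}\subset\mathbb{R}^{n+1}$ (Minkowski sum), where $\Delta_{[i,\dots,j]}=\mathrm{conv}\{e_i,e_{i+1},\dots,e_j\}$. Two polytopes are affinely equivalent if some affine isomorphism between their affine hulls maps one onto the other. *)

theory Defs
  imports "HOL-Analysis.Analysis"
begin

text \<open>
  Throughout, the ambient space \<open>\<real>\<^sup>n\<^sup>+\<^sup>1\<close> is \<open>real ^ 'm\<close>, and \<open>e 1, \<dots>, e (n + 1)\<close> is an
  enumeration of its standard basis, \<open>bij_betw e {1..n+1} Basis\<close>. The parameter \<open>e\<close> only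
  supplies the numbering of the coordinates, which a finite index type does not carry.
\<close>

definition simple_root :: "(nat \<Rightarrow> real ^ 'm) \<Rightarrow> nat \<Rightarrow> real ^ 'm" where
  "simple_root e i = e i - e (i + 1)"

definition positive_root :: "(nat \<Rightarrow> real ^ 'm) \<Rightarrow> nat \<Rightarrow> nat \<Rightarrow> real ^ 'm" where
  "positive_root e i j = (\<Sum>k\<in>{i..j}. simple_root e k)"

definition almost_positive_roots :: "(nat \<Rightarrow> real ^ 'm) \<Rightarrow> nat \<Rightarrow> (real ^ 'm) set" where
  "almost_positive_roots e n =
     {positive_root e i j | i j. 1 \<le> i \<and> i \<le> j \<and> j \<le> n}
     \<union> {- simple_root e i | i. 1 \<le> i \<and> i \<le> n}"

text \<open>
  A diagonal of the convex \<open>(n+3)\<close>-gon with vertices labelled cyclically \<open>1, \<dots>, n+3\<close> is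
  represented by its set of endpoints.
\<close>

definition diagonals :: "nat \<Rightarrow> nat set set" where
  "diagonals n = {{a, b} | a b. 1 \<le> a \<and> a + 1 < b \<and> b \<le> n + 3 \<and> \<not> (a = 1 \<and> b = n + 3)}"

text \<open>
  By convexity, two diagonals meet in their relative interiors in a single point iff their
  endpoints are four distinct vertices that alternate in the cyclic order.
\<close>

definition crosses :: "nat set \<Rightarrow> nat set \<Rightarrow> bool" where
  "crosses d d' \<longleftrightarrow>
     (\<exists>p q r s. p < q \<and> q < r \<and> r < s \<and>
        (d = {p, r} \<and> d' = {q, s} \<or> d = {q, s} \<and> d' = {p, r}))"

definition snake :: "nat \<Rightarrow> nat \<Rightarrow> nat set" where
  "snake n k =
     (if odd k then {(k + 1) div 2, n + 3 - (k + 1) div 2}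
      else {k div 2 + 1, n + 3 - k div 2})"

definition root_diagonal :: "(nat \<Rightarrow> real ^ 'm) \<Rightarrow> nat \<Rightarrow> real ^ 'm \<Rightarrow> nat set" where
  "root_diagonal e n \<beta> = (THE d. d \<in> diagonals n \<and>
     ((\<exists>k. 1 \<le> k \<and> k \<le> n \<and> \<beta> = - simple_root e k \<and> d = snake n k) \<or>
      (\<exists>i j. 1 \<le> i \<and> i \<le> j \<and> j \<le> n \<and> \<beta> = positive_root e i j \<and>
         {k\<in>{1..n}. crosses d (snake n k)} = {i..j})))"

definition compatible :: "(nat \<Rightarrow> real ^ 'm) \<Rightarrow> nat \<Rightarrow> real ^ 'm \<Rightarrow> real ^ 'm \<Rightarrow> bool" where
  "compatible e n \<beta> \<gamma> \<longleftrightarrow> \<not> crosses (root_diagonal e n \<beta>) (root_diagonal e n \<gamma>)"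

definition pairwise_compatible :: "(nat \<Rightarrow> real ^ 'm) \<Rightarrow> nat \<Rightarrow> (real ^ 'm) set \<Rightarrow> bool" where
  "pairwise_compatible e n C \<longleftrightarrow>
     C \<subseteq> almost_positive_roots e n \<and> (\<forall>\<beta>\<in>C. \<forall>\<gamma>\<in>C. compatible e n \<beta> \<gamma>)"

definition clusters :: "(nat \<Rightarrow> real ^ 'm) \<Rightarrow> nat \<Rightarrow> (real ^ 'm) set set" where
  "clusters e n = {C. pairwise_compatible e n C \<and>
     (\<forall>C'. pairwise_compatible e n C' \<and> C \<subseteq> C' \<longrightarrow> C' = C)}"

text \<open>
  A fan is a set of cones closed under passing to nonempty faces, so the fan with maximal cones
  \<open>\<real>\<^sub>\<ge>\<^sub>0 C\<close> consists of the nonempty faces of these cones.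
\<close>

definition cluster_fan :: "(nat \<Rightarrow> real ^ 'm) \<Rightarrow> nat \<Rightarrow> (real ^ 'm) set set" where
  "cluster_fan e n =
     {\<sigma>. \<sigma> \<noteq> {} \<and> (\<exists>C\<in>clusters e n. \<sigma> face_of (convex_cone hull C))}"

definition sum_zero_space :: "(nat \<Rightarrow> real ^ 'm) \<Rightarrow> nat \<Rightarrow> (real ^ 'm) set" where
  "sum_zero_space e n = {x. (\<Sum>i\<in>{1..n+1}. x \<bullet> e i) = 0}"

text \<open>
  The normal fan of a polytope \<open>P \<subseteq> V\<close>, where \<open>V\<close> is a linear subspace identified with its dual
  by the inner product. Outer normals are used; the inner convention replaces \<open>P\<close> by \<open>- P\<close>.
\<close>

definition normal_cone :: "'a::real_inner set \<Rightarrow> 'a set \<Rightarrow> 'a set \<Rightarrow> 'a set" where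
  "normal_cone V P F = {u\<in>V. \<forall>x\<in>F. \<forall>y\<in>P. u \<bullet> y \<le> u \<bullet> x}"

definition normal_fan :: "'a::real_inner set \<Rightarrow> 'a set \<Rightarrow> 'a set set" where
  "normal_fan V P = {normal_cone V P F | F. F face_of P \<and> F \<noteq> {}}"

definition is_Ass_II :: "(nat \<Rightarrow> real ^ 'm) \<Rightarrow> nat \<Rightarrow> (real ^ 'm) set \<Rightarrow> bool" where
  "is_Ass_II e n P \<longleftrightarrow>
     polytope P \<and> P \<subseteq> sum_zero_space e n \<and>
     normal_fan (sum_zero_space e n) P = cluster_fan e n"

text \<open>The sum of sets below is the Minkowski sum.\<close>

definition Ass_III :: "(nat \<Rightarrow> real ^ 'm) \<Rightarrow> nat \<Rightarrow> (nat \<Rightarrow> nat \<Rightarrow> real) \<Rightarrow> (real ^ 'm) set" where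
  "Ass_III e n a =
     (\<Sum>i\<in>{1..n+1}. \<Sum>j\<in>{i..n+1}. (\<lambda>x. a i j *\<^sub>R x) ` (convex hull (e ` {i..j})))"

definition affine_map_on :: "'a::real_vector set \<Rightarrow> ('a \<Rightarrow> 'b::real_vector) \<Rightarrow> bool" where
  "affine_map_on A f \<longleftrightarrow>
     (\<forall>x\<in>A. \<forall>y\<in>A. \<forall>u v. u + v = 1 \<longrightarrow> f (u *\<^sub>R x + v *\<^sub>R y) = u *\<^sub>R f x + v *\<^sub>R f y)"

definition affinely_equivalent :: "'a::real_vector set \<Rightarrow> 'b::real_vector set \<Rightarrow> bool" where
  "affinely_equivalent P Q \<longleftrightarrow>
     (\<exists>f. affine_map_on (affine hull P) f \<and>
          bij_betw f (affine hull P) (affine hull Q) \<and> f ` P = Q)"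

end

theory Submission
  imports Defs
begin

text \<open>
  The two polytopes are told apart by the relative position of their pairs of parallel facets.
  Affine isomorphisms preserve parallelism and disjointness of facets, so it is enough that one
  polytope has, and the other has not, three pairs of parallel facets any two of which contain
  two disjoint facets, one from each pair.

  In the Minkowski sum of the simplices \<open>conv {e i, \<dots>, e j}\<close>, put \<open>w i = e 1 + \<dots> + e i\<close>. The two
  faces on which \<open>w i\<close> is largest and smallest are parallel facets. For \<open>j < i\<close> the face on which
  \<open>w j\<close> is largest is disjoint from the one on which \<open>w i\<close> is smallest, because this is already so
  in the summand \<open>conv {e 1, \<dots>, e (n + 1)}\<close>, where these faces are spanned by \<open>e 1, \<dots>, e j\<close> and by
  \<open>e (i + 1), \<dots>, e (n + 1)\<close>. As \<open>n \<ge> 3\<close>, the indices 1, 2, 3 give three pairs of the required kind.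

  In a polytope whose normal fan is the cluster fan, the facet normals are the almost positive
  roots, and two of them are opposite only if they are \<open>\<alpha> k\<close> and \<open>- \<alpha> k\<close> for a simple root \<open>\<alpha> k\<close>.
  The diagonal of \<open>- \<alpha> k\<close> is the \<open>k\<close>-th snake diagonal and that of \<open>\<alpha> k\<close> is its flip. If \<open>k\<close> and
  \<open>l\<close> differ by at least 2, these diagonals do not cross those for \<open>l\<close>, so every choice of signs
  makes \<open>\<plusminus> \<alpha> k\<close> and \<open>\<plusminus> \<alpha> l\<close> compatible and the corresponding facets meet
  (\<open>Ass_II_simple_roots_meet\<close>). Three pairs as above would thus need three distinct indices any two
  of which are consecutive, and there are none.

  Dimensions of faces do not enter. That the extreme faces of \<open>w i\<close> are facets is used in this dual
  form: a functional that is maximal along such a face is, up to a constant, a nonnegative multiple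
  of \<open>w i\<close> or of \<open>- w i\<close> (\<open>initial_face_rigid\<close>). The affine equivalence is extended to a linear
  automorphism \<open>M\<close> of the whole space (\<open>affine_equivalence_linear\<close>), whose adjoint carries the
  functionals on one polytope to those on the other. A nonzero vector in a cone of the fan forces a
  generator of the fan into that cone (\<open>face_of_convex_cone_hull_generator\<close>), so some almost positive
  root is maximal along each extreme face of \<open>w i\<close>; by rigidity, the roots for the two
  opposite faces are opposite, and hence are a simple root and its negative
  (\<open>initial_is_simple_root\<close>).
\<close>

section \<open>The snake diagonals and their flips\<close>

text \<open>
  The snake is a path \<open>v 0, v 1, \<dots>, v (n + 2)\<close> through all vertices of the polygon, starting at
  \<open>v 0 = n + 3\<close> and \<open>v 1 = 1\<close> and alternating between the two ends of the labelling. Its first and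
  last steps are edges of the polygon, and its \<open>k\<close>-th step is the \<open>k\<close>-th snake diagonal. In these
  positions all crossing conditions become linear inequalities.
\<close>

definition zigzag :: "nat \<Rightarrow> nat \<Rightarrow> nat" where
  "zigzag n k = (if odd k then (k + 1) div 2 else n + 3 - k div 2)"

lemma snake_zigzag: "snake n k = {zigzag n k, zigzag n (k + 1)}"
  by (auto simp: snake_def zigzag_def)

text \<open>
  An order-symmetric form of crossing, which avoids the choice of a labelling for the four
  endpoints.
\<close>

lemma crosses_iff_separates:
  "crosses {a, b} {c, d} \<longleftrightarrow> {a, b} \<inter> {c, d} = {} \<and>
     ((min a b < c \<and> c < max a b) \<noteq> (min a b < d \<and> d < max a b))" (is "?l = ?r")
proof
  show "?l \<Longrightarrow> ?r"
    by (auto simp: crosses_def doubleton_eq_iff)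
next
  assume r: ?r
  define p q where "p = min a b" and "q = max a b"
  define r s where "r = min c d" and "s = max c d"
  have "{a, b} = {p, q}" "{c, d} = {r, s}"
    by (auto simp: p_def q_def r_def s_def min_def max_def)
  moreover have "p < r \<and> r < q \<and> q < s \<or> r < p \<and> p < s \<and> s < q"
    using r by (auto simp: p_def q_def r_def s_def min_def max_def split: if_splits)
  ultimately show ?l
    unfolding crosses_def by metis
qed

lemma crosses_commute: "crosses d d' \<longleftrightarrow> crosses d' d"
  unfolding crosses_def by metis

lemma not_crosses_self: "\<not> crosses d d"
  by (auto simp: crosses_def doubleton_eq_iff)

lemma zigzag_inj: "inj_on (zigzag n) {..n + 2}"
proof (rule inj_onI)
  fix a b assume "a \<in> {..n + 2}" "b \<in> {..n + 2}" "zigzag n a = zigzag n b"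
  then show "a = b"
    unfolding zigzag_def by (cases "even a"; cases "even b"; elim oddE evenE) simp_all
qed

lemma zigzag_surj:
  assumes "1 \<le> x" "x \<le> n + 3"
  shows "\<exists>a\<le>n + 2. zigzag n a = x"
proof (cases "2 * x \<le> n + 3")
  case True
  with assms show ?thesis by (intro exI[of _ "2 * x - 1"]) (auto simp: zigzag_def)
next
  case False
  with assms show ?thesis by (intro exI[of _ "2 * (n + 3 - x)"]) (auto simp: zigzag_def)
qed

text \<open>
  Odd positions carry the small labels in increasing order, even positions the large labels in
  decreasing order.
\<close>

lemma zigzag_less_iff:
  assumes "a \<le> n + 2" "b \<le> n + 2"
  shows "zigzag n a < zigzag n b \<longleftrightarrow> (if odd a then even b \<or> a < b else even b \<and> b < a)"
  using assms unfolding zigzag_def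
  by (cases "even a"; cases "even b"; elim oddE evenE) (simp_all, linarith?)

lemma zigzag_eq_iff:
  assumes "a \<le> n + 2" "b \<le> n + 2"
  shows "zigzag n a = zigzag n b \<longleftrightarrow> a = b"
  using zigzag_inj assms by (auto simp: inj_on_def)

text \<open>
  The snake triangulates the polygon into the triangles \<open>v k, v (k + 1), v (k + 2)\<close>; the segment
  from \<open>v a\<close> to \<open>v b\<close> passes through a consecutive run of them and so meets exactly the snake
  diagonals strictly between its ends.
\<close>

lemma crosses_snake_iff:
  assumes "a < b" "b \<le> n + 2" "1 \<le> k" "k \<le> n"
  shows "crosses {zigzag n a, zigzag n b} (snake n k) \<longleftrightarrow> a < k \<and> k + 1 < b"
proof -
  have le: "a \<le> n + 2" "b \<le> n + 2" "k \<le> n + 2" "k + 1 \<le> n + 2"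
    using assms by auto
  show ?thesis
    unfolding snake_zigzag crosses_iff_separates min_less_iff_disj less_max_iff_disj
    using assms(1) le
    by (cases "even a"; cases "even b"; cases "even k")
      (auto simp: zigzag_less_iff zigzag_eq_iff simp del: One_nat_def)
qed

text \<open>
  The other diagonal of the quadrilateral formed by the two triangles that share the \<open>k\<close>-th snake
  diagonal.
\<close>

definition flip :: "nat \<Rightarrow> nat \<Rightarrow> nat set" where
  "flip n k = {zigzag n (k - 1), zigzag n (k + 2)}"

lemma not_crosses_snakes:
  assumes "k \<in> {1..n}" "l \<in> {1..n}"
  shows "\<not> crosses (snake n k) (snake n l)"
  using assms crosses_snake_iff[of k "k + 1" n l] by (simp add: snake_zigzag)

lemma crosses_flip_snake:
  assumes "k \<in> {1..n}" "l \<in> {1..n}"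
  shows "crosses (flip n k) (snake n l) \<longleftrightarrow> l = k"
  using assms crosses_snake_iff[of "k - 1" "k + 2" n l] by (auto simp: flip_def)

text \<open>
  The quadrilaterals of the two flips occupy the positions \<open>k - 1, \<dots>, k + 2\<close> and
  \<open>l - 1, \<dots>, l + 2\<close> of the snake, so they share at most an edge.
\<close>

lemma not_crosses_flips:
  assumes "1 \<le> k" "k + 2 \<le> l" "l \<le> n"
  shows "\<not> crosses (flip n k) (flip n l)"
proof -
  have le: "k - 1 \<le> n + 2" "k + 2 \<le> n + 2" "l - 1 \<le> n + 2" "l + 2 \<le> n + 2"
    using assms by auto
  have gap: "k + 2 \<le> l - 1" if "even k \<noteq> even l"
    using that assms by presburger
  show ?thesis
    unfolding flip_def crosses_iff_separates min_less_iff_disj less_max_iff_disj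
    using assms le gap
    by (cases "even k"; cases "even l") (auto simp: zigzag_less_iff zigzag_eq_iff)
qed

lemma snake_diagonal:
  assumes "k \<in> {1..n}"
  shows "snake n k \<in> diagonals n"
proof (cases "even k")
  case True
  then show ?thesis using assms
    unfolding snake_def diagonals_def
    by (intro CollectI exI[of _ "k div 2 + 1"] exI[of _ "n + 3 - k div 2"]) (auto elim!: evenE)
next
  case False
  then show ?thesis using assms
    unfolding snake_def diagonals_def
    by (intro CollectI exI[of _ "(k + 1) div 2"] exI[of _ "n + 3 - (k + 1) div 2"])
      (auto elim!: oddE)
qed

lemma flip_diagonal:
  assumes "k \<in> {1..n}"
  shows "flip n k \<in> diagonals n"
proof (cases "even k")
  case True
  then show ?thesis using assms
    unfolding flip_def zigzag_def diagonals_def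
    by (intro CollectI exI[of _ "k div 2"] exI[of _ "n + 2 - k div 2"]) (auto elim!: evenE)
next
  case False
  then show ?thesis using assms
    unfolding flip_def zigzag_def diagonals_def
    by (intro CollectI exI[of _ "(k + 1) div 2 + 1"] exI[of _ "n + 3 - (k - 1) div 2"])
      (auto elim!: oddE)
qed

text \<open>
  Since \<open>{v a, v b}\<close> crosses the snake diagonals strictly between positions \<open>a\<close> and \<open>b - 1\<close>, meeting
  only the \<open>k\<close>-th one forces \<open>a = k - 1\<close> and \<open>b = k + 2\<close>. This makes the diagonal of a simple root
  well defined.
\<close>

lemma flip_unique:
  assumes "k \<in> {1..n}"  "d \<in> diagonals n" "{l\<in>{1..n}. crosses d (snake n l)} = {k}"
  shows "d = flip n k"
proof -
  obtain x y where xy: "d = {x, y}" "1 \<le> x" "x < y" "y \<le> n + 3"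
    using assms(2) by (auto simp: diagonals_def)
  obtain a' b' where "a' \<le> n + 2" "b' \<le> n + 2" "zigzag n a' = x" "zigzag n b' = y"
    using zigzag_surj[of x n] zigzag_surj[of y n] xy by auto
  then obtain a b where ab: "a < b" "b \<le> n + 2" "d = {zigzag n a, zigzag n b}"
    using xy by (metis insert_commute linorder_neqE_nat nless_le)
  have *: "1 \<le> l \<and> l \<le> n \<and> a < l \<and> l + 1 < b \<longleftrightarrow> l = k" for l
    using assms(3) crosses_snake_iff[OF ab(1,2), of l] unfolding ab(3) by auto
  have "a = k - 1" "b = k + 2"
    using *[of k] *[of "k - 1"] *[of "k + 1"] ab by auto
  then show ?thesis
    using ab(3) by (simp add: flip_def)
qed

section \<open>Roots in coordinates\<close>

locale numbered_basis =
  fixes n :: nat and e :: "nat \<Rightarrow> real ^ 'm"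
  assumes basis: "bij_betw e {1..n + 1} Basis"
begin

lemma e_inner_e:
  assumes "i \<in> {1..n + 1}" "j \<in> {1..n + 1}"
  shows "e i \<bullet> e j = (if i = j then 1 else 0)"
proof -
  have "e i \<in> Basis" "e j \<in> Basis" "e i = e j \<longleftrightarrow> i = j"
    using assms basis by (auto simp: bij_betw_def inj_on_def)
  then show ?thesis by (simp add: inner_Basis)
qed

lemma e_expansion: "(\<Sum>k\<in>{1..n + 1}. (x \<bullet> e k) *\<^sub>R e k) = x"
proof -
  have "(\<Sum>k\<in>{1..n + 1}. (x \<bullet> e k) *\<^sub>R e k) = (\<Sum>b\<in>Basis. (x \<bullet> b) *\<^sub>R b)"
    by (rule sum.reindex_bij_betw[OF basis])
  then show ?thesis by (simp add: euclidean_representation)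
qed

lemma e_eqI: "(\<And>k. k \<in> {1..n + 1} \<Longrightarrow> x \<bullet> e k = y \<bullet> e k) \<Longrightarrow> x = y"
  by (subst e_expansion[of x, symmetric], subst e_expansion[of y, symmetric]) (simp del: One_nat_def)

definition initial :: "nat \<Rightarrow> real ^ 'm" where
  "initial i = (\<Sum>k\<in>{1..i}. e k)"

lemma initial_inner_e:
  assumes "i \<le> n + 1" "l \<in> {1..n + 1}"
  shows "initial i \<bullet> e l = (if l \<le> i then 1 else 0)"
proof -
  have "initial i \<bullet> e l = (\<Sum>k\<in>{1..i}. if k = l then 1 else 0)"
    unfolding initial_def inner_sum_left using assms by (intro sum.cong) (auto simp: e_inner_e)
  then show ?thesis using assms by simp
qed

text \<open>
  The normal vector of the hyperplane in which the roots live. Functionals on either polytope matter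
  only up to multiples of it.
\<close>

definition ones :: "real ^ 'm" where
  "ones = initial (n + 1)"

lemma ones_inner_e: "l \<in> {1..n + 1} \<Longrightarrow> ones \<bullet> e l = 1"
  by (simp add: ones_def initial_inner_e)

lemma sum_zero_space_iff: "x \<in> sum_zero_space e n \<longleftrightarrow> x \<bullet> ones = 0"
  unfolding sum_zero_space_def ones_def initial_def inner_sum_right by simp

lemma positive_root_eq:
  assumes "i \<le> j"
  shows "positive_root e i j = e i - e (j + 1)"
  using sum_Suc_diff[of i "j" "\<lambda>k. - e k"] assms
  by (simp add: positive_root_def simple_root_def)

lemma simple_root_inner_e:
  assumes "k \<in> {1..n}" "l \<in> {1..n + 1}"
  shows "simple_root e k \<bullet> e l = (if l = k then 1 else if l = k + 1 then - 1 else 0)"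
  using assms by (simp add: simple_root_def inner_diff_left e_inner_e)

lemma positive_root_inner_e:
  assumes "1 \<le> i" "i \<le> j" "j \<le> n" "l \<in> {1..n + 1}"
  shows "positive_root e i j \<bullet> e l = (if l = i then 1 else if l = j + 1 then - 1 else 0)"
  using assms by (simp add: positive_root_eq inner_diff_left e_inner_e)

lemma simple_root_eq_iff:
  assumes "k \<in> {1..n}" "l \<in> {1..n}"
  shows "simple_root e k = simple_root e l \<longleftrightarrow> k = l"
  using simple_root_inner_e[OF assms(1), of l] simple_root_inner_e[OF assms(2), of l] assms
    simple_root_inner_e[OF assms(1), of k] simple_root_inner_e[OF assms(2), of k]
  by (auto split: if_splits)

lemma positive_root_sum_zero:
  assumes "1 \<le> i" "i \<le> j" "j \<le> n"
  shows "positive_root e i j \<in> sum_zero_space e n"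
  using assms ones_inner_e[of i] ones_inner_e[of "j + 1"]
  by (simp add: sum_zero_space_iff positive_root_eq inner_diff_left inner_commute[of _ ones] inner_diff_right)

text \<open>
  At the smaller of the two left endpoints both roots have a nonnegative coordinate, and one of them
  a positive one.
\<close>

lemma opposite_positive_roots:
  assumes "1 \<le> i" "i \<le> j" "j \<le> n" "1 \<le> i'" "i' \<le> j'" "j' \<le> n" "p > 0" "q > 0"
  shows "p *\<^sub>R positive_root e i j + q *\<^sub>R positive_root e i' j' \<noteq> 0"
proof
  assume 0: "p *\<^sub>R positive_root e i j + q *\<^sub>R positive_root e i' j' = 0"
  have "(p *\<^sub>R positive_root e i j + q *\<^sub>R positive_root e i' j') \<bullet> e (min i i') > 0"
    using assms by (simp add: inner_add_left positive_root_inner_e min_def add_pos_nonneg)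
  then show False using 0 by simp
qed

lemma proportional_positive_roots:
  assumes "1 \<le> i" "i \<le> j" "j \<le> n" "1 \<le> i'" "i' \<le> j'" "j' \<le> n" "p > 0"
    and eq: "p *\<^sub>R positive_root e i j = q *\<^sub>R positive_root e i' j'"  and "q > 0"
  shows "i = i' \<and> j = j'"
proof -
  have *: "p * (positive_root e i j \<bullet> e l) = q * (positive_root e i' j' \<bullet> e l)" for l
    using eq by (metis inner_scaleR_left)
  show ?thesis
    using *[of i] *[of "j + 1"] assms by (auto simp: positive_root_inner_e split: if_splits)
qed

text \<open>
  A positive root is a sum of simple roots, so it is opposite to a negative simple root only if the
  sum has one term. In the geometry, these are the only candidates for pairs of parallel facets.
\<close>

lemma opposite_roots:
  assumes "\<beta> \<in> almost_positive_roots e n" "\<gamma> \<in> almost_positive_roots e n"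
    and "p > 0" "q > 0" and zero: "p *\<^sub>R \<beta> + q *\<^sub>R \<gamma> = 0"
  obtains k where "k \<in> {1..n}" "\<beta> = simple_root e k \<or> \<beta> = - simple_root e k"
proof -
  have simple: "simple_root e k = positive_root e k k" for k
    by (simp add: positive_root_def)
  have root_cases: "(\<exists>i j. 1 \<le> i \<and> i \<le> j \<and> j \<le> n \<and> \<delta> = positive_root e i j) \<or>
      (\<exists>k\<in>{1..n}. \<delta> = - simple_root e k)" if "\<delta> \<in> almost_positive_roots e n" for \<delta>
    using that unfolding almost_positive_roots_def by auto
  show ?thesis
  proof (cases "\<exists>k\<in>{1..n}. \<beta> = - simple_root e k")
    case True
    then show ?thesis using that by blast
  next
    case False
    then obtain i j where ij: "1 \<le> i" "i \<le> j" "j \<le> n" "\<beta> = positive_root e i j"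
      using root_cases[OF assms(1)] by blast
    show ?thesis
    proof (cases "\<exists>k\<in>{1..n}. \<gamma> = - simple_root e k")
      case True
      then obtain k where k: "k \<in> {1..n}" "\<gamma> = - simple_root e k" by blast
      then have "p *\<^sub>R positive_root e i j = q *\<^sub>R positive_root e k k"
        using zero ij by (simp add: simple)
      then have "i = k \<and> j = k"
        using proportional_positive_roots[OF ij(1-3) _ _ _ \<open>p > 0\<close> _ \<open>q > 0\<close>, of k k] k by simp
      then show ?thesis using that k ij by (auto simp: simple)
    next
      case False
      then obtain i' j' where "1 \<le> i'" "i' \<le> j'" "j' \<le> n" "\<gamma> = positive_root e i' j'"
        using root_cases[OF assms(2)] by blast
      then show ?thesis
        using opposite_positive_roots[OF ij(1-3)] ij(4) assms(3,4) zero by blast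
    qed
  qed
qed

lemma almost_positive_root_sum_zero:
  assumes "\<beta> \<in> almost_positive_roots e n"
  shows "\<beta> \<in> sum_zero_space e n" "\<beta> \<noteq> 0"
proof -
  have root: "positive_root e i j \<in> sum_zero_space e n \<and> positive_root e i j \<noteq> 0"
    if "1 \<le> i" "i \<le> j" "j \<le> n" for i j
    using positive_root_sum_zero[OF that] positive_root_inner_e[OF that, of i] that by auto
  obtain i j where "1 \<le> i" "i \<le> j" "j \<le> n" "\<beta> = positive_root e i j \<or> \<beta> = - positive_root e i j"
    using assms unfolding almost_positive_roots_def
    by (force simp: positive_root_def)
  then show "\<beta> \<in> sum_zero_space e n" "\<beta> \<noteq> 0"
    using root[of i j] by (auto simp: sum_zero_space_iff)
qed

lemma finite_almost_positive_roots: "finite (almost_positive_roots e n)"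
proof -
  have "almost_positive_roots e n \<subseteq>
      (\<lambda>(i, j). positive_root e i j) ` ({1..n} \<times> {1..n}) \<union> (\<lambda>i. - simple_root e i) ` {1..n}"
    unfolding almost_positive_roots_def by force
  then show ?thesis by (rule finite_subset) auto
qed

lemma root_diagonal_negative:
  assumes "k \<in> {1..n}"
  shows "root_diagonal e n (- simple_root e k) = snake n k"
  unfolding root_diagonal_def
proof (rule the_equality)
  show "snake n k \<in> diagonals n \<and>
    ((\<exists>l. 1 \<le> l \<and> l \<le> n \<and> - simple_root e k = - simple_root e l \<and> snake n k = snake n l) \<or>
     (\<exists>i j. 1 \<le> i \<and> i \<le> j \<and> j \<le> n \<and> - simple_root e k = positive_root e i j \<and>
        {l \<in> {1..n}. crosses (snake n k) (snake n l)} = {i..j}))"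
    using assms snake_diagonal by auto
  have "- simple_root e k \<noteq> positive_root e i j" if "1 \<le> i" "i \<le> j" "j \<le> n" for i j
    using opposite_positive_roots[OF that, of k k 1 1] assms
    by (simp add: positive_root_def neg_eq_iff_add_eq_0 add.commute)
  then show "d = snake n k" if "d \<in> diagonals n \<and>
    ((\<exists>l. 1 \<le> l \<and> l \<le> n \<and> - simple_root e k = - simple_root e l \<and> d = snake n l) \<or>
     (\<exists>i j. 1 \<le> i \<and> i \<le> j \<and> j \<le> n \<and> - simple_root e k = positive_root e i j \<and>
        {l \<in> {1..n}. crosses d (snake n l)} = {i..j}))" for d
    using that assms simple_root_eq_iff by auto
qed

lemma root_diagonal_simple:
  assumes "k \<in> {1..n}"
  shows "root_diagonal e n (simple_root e k) = flip n k"
  unfolding root_diagonal_def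
proof (rule the_equality)
  have "{l \<in> {1..n}. crosses (flip n k) (snake n l)} = {k..k}"
    using assms crosses_flip_snake by auto
  then show "flip n k \<in> diagonals n \<and>
    ((\<exists>l. 1 \<le> l \<and> l \<le> n \<and> simple_root e k = - simple_root e l \<and> flip n k = snake n l) \<or>
     (\<exists>i j. 1 \<le> i \<and> i \<le> j \<and> j \<le> n \<and> simple_root e k = positive_root e i j \<and>
        {l \<in> {1..n}. crosses (flip n k) (snake n l)} = {i..j}))"
    using assms flip_diagonal[OF assms]
    by (intro conjI disjI2 exI[of _ k]) (auto simp: positive_root_def)
  have neg: "simple_root e k \<noteq> - simple_root e l" if "1 \<le> l" "l \<le> n" for l
    using opposite_positive_roots[of k k l l 1 1] assms that
    by (simp add: positive_root_def eq_neg_iff_add_eq_0)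
  have uniq: "i = k \<and> j = k"
    if "1 \<le> i" "i \<le> j" "j \<le> n" "simple_root e k = positive_root e i j" for i j
    using proportional_positive_roots[of i j k k 1 1] that assms by (auto simp: positive_root_def)
  show "d = flip n k" if "d \<in> diagonals n \<and>
    ((\<exists>l. 1 \<le> l \<and> l \<le> n \<and> simple_root e k = - simple_root e l \<and> d = snake n l) \<or>
     (\<exists>i j. 1 \<le> i \<and> i \<le> j \<and> j \<le> n \<and> simple_root e k = positive_root e i j \<and>
        {l \<in> {1..n}. crosses d (snake n l)} = {i..j}))" for d
    using that
  proof (elim conjE disjE exE)
    fix i j
    assume "d \<in> diagonals n" and ij: "1 \<le> i" "i \<le> j" "j \<le> n"
      "simple_root e k = positive_root e i j" and "{l \<in> {1..n}. crosses d (snake n l)} = {i..j}"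
    moreover from this have "i = k" "j = k"
      using uniq by blast+
    ultimately show "d = flip n k"
      using flip_unique[OF assms] by simp
  qed (use neg in blast)
qed

text \<open>
  The four sign choices correspond to two snake diagonals, to a snake diagonal and the flip of
  another one, and to two flips at distance at least 2; none of these pairs cross.
\<close>

lemma signed_simple_roots_in_cluster:
  assumes "k \<in> {1..n}" "l \<in> {1..n}" "k + 2 \<le> l"
    and "\<beta> = simple_root e k \<or> \<beta> = - simple_root e k"
    and "\<gamma> = simple_root e l \<or> \<gamma> = - simple_root e l"
  obtains C where "C \<in> clusters e n" "\<beta> \<in> C" "\<gamma> \<in> C"
proof -
  have roots: "simple_root e i \<in> almost_positive_roots e n \<and> - simple_root e i \<in> almost_positive_roots e n"
    if "i \<in> {1..n}" for i
    using that by (auto simp: almost_positive_roots_def positive_root_def intro!: exI[of _ i])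
  have "compatible e n \<beta> \<gamma>"
    using assms crosses_commute[of "snake n k" "flip n l"]
    by (elim disjE) (simp_all add: compatible_def root_diagonal_simple root_diagonal_negative
        not_crosses_snakes crosses_flip_snake not_crosses_flips)
  moreover have "compatible e n \<delta> \<delta>" for \<delta>
    by (simp add: compatible_def not_crosses_self)
  ultimately have pair: "pairwise_compatible e n {\<beta>, \<gamma>}"
    using assms(1,2,4,5) roots crosses_commute unfolding pairwise_compatible_def compatible_def
    by blast
  have "finite {C. pairwise_compatible e n C}"
    by (rule finite_subset[of _ "Pow (almost_positive_roots e n)"])
      (auto simp: pairwise_compatible_def finite_almost_positive_roots)
  then obtain C where "pairwise_compatible e n C" "{\<beta>, \<gamma>} \<subseteq> C"
      "\<forall>C'\<in>{C. pairwise_compatible e n C}. C \<subseteq> C' \<longrightarrow> C = C'"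
    using finite_has_maximal2[of "{C. pairwise_compatible e n C}" "{\<beta>, \<gamma>}"] pair by blast
  then show ?thesis
    using that unfolding clusters_def by blast
qed

end

section \<open>Faces, normal cones and affine maps\<close>

definition maximizers :: "'a::real_inner \<Rightarrow> 'a set \<Rightarrow> 'a set" where
  "maximizers w S = {x \<in> S. \<forall>y\<in>S. w \<bullet> y \<le> w \<bullet> x}"

lemma maximizers_face_of:
  assumes "convex S"
  shows "maximizers w S face_of S"
proof (cases "maximizers w S = {}")
  case False
  then obtain x where x: "x \<in> S" "\<forall>y\<in>S. w \<bullet> y \<le> w \<bullet> x"
    by (auto simp: maximizers_def)
  then have "maximizers w S = S \<inter> {y. w \<bullet> y = w \<bullet> x}"
    by (auto simp: maximizers_def intro!: antisym)
  then show ?thesis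
    using face_of_Int_supporting_hyperplane_le[of S w "w \<bullet> x"] assms x by simp
qed (simp add: empty_face_of)

text \<open>
  A nonzero element of a generated cone uses some generator with positive coefficient. The elements
  with this property, together with 0, form a convex cone that contains all generators.
\<close>

lemma convex_cone_hull_subtract_generator:
  assumes "x \<in> convex_cone hull S" "x \<noteq> 0"
  shows "\<exists>s\<in>S. \<exists>c>0. x - c *\<^sub>R s \<in> convex_cone hull S"
proof -
  let ?H = "convex_cone hull S"
  let ?G = "{x \<in> ?H. x = 0 \<or> (\<exists>s\<in>S. \<exists>c>0. x - c *\<^sub>R s \<in> ?H)}"
  have "convex_cone ?G"
  proof (rule convex_cone_iff[THEN iffD2], intro conjI ballI allI impI)
    show "0 \<in> ?G" by (simp add: convex_cone_hull_contains_0)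
  next
    fix x y assume xy: "x \<in> ?G" "y \<in> ?G"
    then have H: "x \<in> ?H" "y \<in> ?H" "x + y \<in> ?H"
      by (auto intro: convex_cone_hull_add)
    have "\<exists>s\<in>S. \<exists>c>0. x + y - c *\<^sub>R s \<in> ?H" if "x \<noteq> 0"
    proof -
      obtain s c where "s \<in> S" "c > 0" "x - c *\<^sub>R s \<in> ?H" using xy \<open>x \<noteq> 0\<close> by auto
      then show ?thesis
        using convex_cone_hull_add[of "x - c *\<^sub>R s" S y] H by (auto simp: algebra_simps)
    qed
    then show "x + y \<in> ?G"
      using xy H by (cases "x = 0") auto
  next
    fix x and t :: real assume x: "x \<in> ?G" and "t \<ge> 0"
    then have H: "t *\<^sub>R x \<in> ?H" by (auto intro: convex_cone_hull_mul)
    show "t *\<^sub>R x \<in> ?G"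
    proof (cases "t *\<^sub>R x = 0")
      case False
      then obtain s c where "s \<in> S" "c > 0" "x - c *\<^sub>R s \<in> ?H" using x by auto
      moreover have "t > 0" using False \<open>t \<ge> 0\<close> by (cases "t = 0") auto
      ultimately have "s \<in> S" "t * c > 0" "t *\<^sub>R x - (t * c) *\<^sub>R s \<in> ?H"
        using convex_cone_hull_mul[of "x - c *\<^sub>R s" S t] by (auto simp: algebra_simps)
      then show ?thesis using H by blast
    qed (use H in simp)
  qed
  moreover have "S \<subseteq> ?G"
  proof
    fix s assume "s \<in> S"
    then have "s \<in> ?H" "s - 1 *\<^sub>R s \<in> ?H"
      by (auto simp: hull_inc convex_cone_hull_contains_0)
    then show "s \<in> ?G" using \<open>s \<in> S\<close> zero_less_one by blast
  qed
  ultimately have "?H \<subseteq> ?G" by (simp add: hull_minimal)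
  then show ?thesis using assms by auto
qed

text \<open>
  The point \<open>x\<close> is the midpoint of a positive multiple of some generator and another element of
  the cone, and a face contains both ends of a segment that it meets in an inner point.
\<close>

lemma face_of_convex_cone_hull_generator:
  assumes face: "\<sigma> face_of (convex_cone hull S)" and "x \<in> \<sigma>" "x \<noteq> 0"
  shows "\<exists>s\<in>S. \<exists>c>0. c *\<^sub>R s \<in> \<sigma>"
proof -
  have "x \<in> convex_cone hull S" using assms face_of_imp_subset by blast
  then obtain s c where s: "s \<in> S" "c > 0" "x - c *\<^sub>R s \<in> convex_cone hull S"
    using convex_cone_hull_subtract_generator \<open>x \<noteq> 0\<close> by blast
  let ?p = "(2 * c) *\<^sub>R s" and ?q = "2 *\<^sub>R (x - c *\<^sub>R s)"
  have pq: "?p \<in> convex_cone hull S" "?q \<in> convex_cone hull S"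
    using s by (auto intro: convex_cone_hull_mul hull_inc)
  have mid: "x = midpoint ?p ?q"
    by (simp add: midpoint_def algebra_simps)
  have "?p \<in> \<sigma>"
  proof (cases "?p = ?q")
    case True
    then show ?thesis using mid \<open>x \<in> \<sigma>\<close> by simp
  next
    case False
    then have "x \<in> open_segment ?p ?q"
      using mid by (metis midpoint_in_open_segment)
    then show ?thesis using face pq \<open>x \<in> \<sigma>\<close> unfolding face_of_def by blast
  qed
  then show ?thesis using s by (intro bexI[of _ s] exI[of _ "2 * c"]) auto
qed

lemma affine_combination_mem:
  fixes g :: "'i \<Rightarrow> 'a::real_vector"
  assumes "affine S" "finite I" "sum c I = 1" "\<And>i. i \<in> I \<Longrightarrow> g i \<in> S"
  shows "(\<Sum>i\<in>I. c i *\<^sub>R g i) \<in> S"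
proof -
  obtain i where "i \<in> I" using assms(3) by fastforce
  then have i: "g i \<in> S" using assms by blast
  have sub: "subspace ((\<lambda>x. x - g i) ` S)"
    using affine_diffs_subspace_subtract[OF assms(1) i] .
  have "(\<Sum>j\<in>I. c j *\<^sub>R (g j - g i)) \<in> (\<lambda>x. x - g i) ` S"
    using assms(4) by (intro subspace_sum[OF sub] subspace_scale[OF sub]) auto
  moreover have "(\<Sum>j\<in>I. c j *\<^sub>R (g j - g i)) = (\<Sum>j\<in>I. c j *\<^sub>R g j) - g i"
    using assms(3) by (simp add: scaleR_diff_right sum_subtractf flip: scaleR_left.sum)
  ultimately show ?thesis by auto
qed

text \<open>
  The graph of an affine map is an affine set, so it is closed under affine combinations of any
  finite number of points.
\<close>

lemma affine_map_on_combination: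
  fixes g :: "'i \<Rightarrow> 'a::real_vector" and f :: "'a \<Rightarrow> 'b::real_vector"
  assumes "affine_map_on A f" "affine A" "finite I" "sum c I = 1" "\<And>i. i \<in> I \<Longrightarrow> g i \<in> A"
  shows "(\<Sum>i\<in>I. c i *\<^sub>R g i) \<in> A" "f (\<Sum>i\<in>I. c i *\<^sub>R g i) = (\<Sum>i\<in>I. c i *\<^sub>R f (g i))"
proof -
  have "affine ((\<lambda>x. (x, f x)) ` A)"
    using assms(1,2) unfolding affine_def affine_map_on_def by (auto simp: image_iff)
  then have "(\<Sum>i\<in>I. c i *\<^sub>R (g i, f (g i))) \<in> (\<lambda>x. (x, f x)) ` A"
    using assms by (intro affine_combination_mem) auto
  moreover have "(\<Sum>i\<in>I. c i *\<^sub>R (g i, f (g i))) = (\<Sum>i\<in>I. c i *\<^sub>R g i, \<Sum>i\<in>I. c i *\<^sub>R f (g i))"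
    by (simp add: sum_prod)
  ultimately show "(\<Sum>i\<in>I. c i *\<^sub>R g i) \<in> A" "f (\<Sum>i\<in>I. c i *\<^sub>R g i) = (\<Sum>i\<in>I. c i *\<^sub>R f (g i))"
    by auto
qed

section \<open>Polytopes with the cluster fan\<close>

context numbered_basis
begin

text \<open>
  The normal cone of the face where \<open>u\<close> is maximal belongs to the fan and contains \<open>u\<close>, so it
  contains a generator of the fan, and this is an almost positive root.
\<close>

lemma Ass_II_maximizers_subset_root:
  assumes "is_Ass_II e n P" "u \<in> sum_zero_space e n" "u \<noteq> 0" "maximizers u P \<noteq> {}"
  obtains \<beta> where "\<beta> \<in> almost_positive_roots e n" "maximizers u P \<subseteq> maximizers \<beta> P"
proof -
  let ?F = "maximizers u P"
  let ?\<sigma> = "normal_cone (sum_zero_space e n) P ?F"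
  have "?F face_of P"
    using assms(1) by (intro maximizers_face_of) (auto simp: is_Ass_II_def polytope_imp_convex)
  then have "?\<sigma> \<in> normal_fan (sum_zero_space e n) P"
    using assms(4) unfolding normal_fan_def by blast
  then obtain C where C: "C \<in> clusters e n" "?\<sigma> face_of (convex_cone hull C)"
    using assms(1) unfolding is_Ass_II_def cluster_fan_def by blast
  have "u \<in> ?\<sigma>"
    using assms(2) by (auto simp: normal_cone_def maximizers_def)
  then obtain \<beta> c where \<beta>: "\<beta> \<in> C" "c > 0" "c *\<^sub>R \<beta> \<in> ?\<sigma>"
    using face_of_convex_cone_hull_generator[OF C(2) _ assms(3)] by blast
  then have "\<beta> \<in> almost_positive_roots e n"
    using C(1) unfolding clusters_def pairwise_compatible_def by blast
  moreover have "maximizers u P \<subseteq> maximizers \<beta> P"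
    using \<beta>(2,3) by (auto simp: normal_cone_def maximizers_def)
  ultimately show ?thesis by (rule that)
qed

text \<open>
  Both roots lie in one cone of the fan, so they are maximal along a common nonempty face.
\<close>

lemma Ass_II_simple_roots_meet:
  assumes "is_Ass_II e n P" "k \<in> {1..n}" "l \<in> {1..n}" "k + 2 \<le> l"
    and "\<beta> = simple_root e k \<or> \<beta> = - simple_root e k"
    and "\<gamma> = simple_root e l \<or> \<gamma> = - simple_root e l"
  shows "maximizers \<beta> P \<inter> maximizers \<gamma> P \<noteq> {}"
proof -
  obtain C where C: "C \<in> clusters e n" "\<beta> \<in> C" "\<gamma> \<in> C"
    by (rule signed_simple_roots_in_cluster[OF assms(2-6)])
  then have "convex_cone hull C \<in> cluster_fan e n"
    unfolding cluster_fan_def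
    using face_of_refl[OF convex_convex_cone_hull] convex_cone_hull_nonempty by blast
  then obtain F where F: "F face_of P" "F \<noteq> {}"
      "convex_cone hull C = normal_cone (sum_zero_space e n) P F"
    using assms(1) unfolding is_Ass_II_def normal_fan_def by blast
  then obtain x where "x \<in> F" "x \<in> P"
    using face_of_imp_subset by blast
  moreover have "\<beta> \<in> normal_cone (sum_zero_space e n) P F" "\<gamma> \<in> normal_cone (sum_zero_space e n) P F"
    using C(2,3) hull_inc[of _ C convex_cone] unfolding F(3)[symmetric] by blast+
  ultimately have "x \<in> maximizers \<beta> P \<inter> maximizers \<gamma> P"
    by (auto simp: normal_cone_def maximizers_def)
  then show ?thesis by blast
qed

section \<open>The Minkowski sum of simplices\<close>

definition intervals :: "(nat \<times> nat) set" where
  "intervals = (SIGMA i:{1..n + 1}. {i..n + 1})"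

definition coord_simplex :: "nat \<times> nat \<Rightarrow> (real ^ 'm) set" where
  "coord_simplex t = convex hull (e ` {fst t..snd t})"

lemma finite_intervals: "finite intervals"
  by (simp add: intervals_def)

lemma Ass_III_eq:
  "Ass_III e n a =
    {(\<Sum>t\<in>intervals. a (fst t) (snd t) *\<^sub>R s t) | s. \<forall>t\<in>intervals. s t \<in> coord_simplex t}"
    (is "_ = ?R")
proof -
  have "Ass_III e n a = (\<Sum>(i, j)\<in>intervals. (\<lambda>x. a i j *\<^sub>R x) ` (convex hull (e ` {i..j})))"
    unfolding Ass_III_def intervals_def by (rule sum.Sigma) auto
  also have "\<dots> = (\<Sum>t\<in>intervals. (\<lambda>x. a (fst t) (snd t) *\<^sub>R x) ` coord_simplex t)"
    by (simp add: coord_simplex_def case_prod_beta)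
  also have "\<dots> = {\<Sum>t\<in>intervals. r t | r. \<forall>t\<in>intervals. r t \<in> (\<lambda>x. a (fst t) (snd t) *\<^sub>R x) ` coord_simplex t}"
    by (rule set_sum_alt[OF finite_intervals])
  also have "\<dots> = ?R"
  proof (intro subset_antisym subsetI)
    fix y assume "y \<in> {\<Sum>t\<in>intervals. r t | r. \<forall>t\<in>intervals. r t \<in> (\<lambda>x. a (fst t) (snd t) *\<^sub>R x) ` coord_simplex t}"
    then obtain r where y: "y = (\<Sum>t\<in>intervals. r t)"
      and "\<forall>t\<in>intervals. r t \<in> (\<lambda>x. a (fst t) (snd t) *\<^sub>R x) ` coord_simplex t"
      by blast
    then have r: "\<forall>t\<in>intervals. \<exists>x. x \<in> coord_simplex t \<and> r t = a (fst t) (snd t) *\<^sub>R x"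
      by blast
    obtain s where s: "\<forall>t\<in>intervals. s t \<in> coord_simplex t \<and> r t = a (fst t) (snd t) *\<^sub>R s t"
      using bchoice[OF r] by blast
    then have "y = (\<Sum>t\<in>intervals. a (fst t) (snd t) *\<^sub>R s t)"
      unfolding y by (intro sum.cong) auto
    then show "y \<in> ?R" using s by blast
  next
    fix y assume "y \<in> ?R"
    then obtain s where s: "y = (\<Sum>t\<in>intervals. a (fst t) (snd t) *\<^sub>R s t)" "\<forall>t\<in>intervals. s t \<in> coord_simplex t"
      by blast
    then show "y \<in> {\<Sum>t\<in>intervals. r t | r. \<forall>t\<in>intervals. r t \<in> (\<lambda>x. a (fst t) (snd t) *\<^sub>R x) ` coord_simplex t}"
      by (intro CollectI exI[of _ "\<lambda>t. a (fst t) (snd t) *\<^sub>R s t"]) auto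
  qed
  finally show ?thesis .
qed

lemma Ass_III_memE:
  assumes "y \<in> Ass_III e n a"
  obtains s where "y = (\<Sum>t\<in>intervals. a (fst t) (snd t) *\<^sub>R s t)"
    "\<forall>t\<in>intervals. s t \<in> coord_simplex t"
  using assms unfolding Ass_III_eq by blast

lemma e_in_coord_simplex: "k \<in> {fst t..snd t} \<Longrightarrow> e k \<in> coord_simplex t"
  unfolding coord_simplex_def by (intro hull_inc) auto

lemma coord_simplex_inner_le:
  assumes "p \<in> coord_simplex t" "\<And>k. k \<in> {fst t..snd t} \<Longrightarrow> w \<bullet> e k \<le> b"
  shows "w \<bullet> p \<le> b"
proof -
  have "coord_simplex t \<subseteq> {x. w \<bullet> x \<le> b}"
    unfolding coord_simplex_def using assms(2) by (intro hull_minimal) (auto simp: convex_halfspace_le)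
  then show ?thesis using assms(1) by blast
qed

text \<open>
  Replacing one summand of a point by another point of the same simplex. Comparing a maximizer with
  such a modified point shows that it is maximal in each summand separately.
\<close>

lemma Ass_III_move:
  assumes "\<forall>t\<in>intervals. s t \<in> coord_simplex t" "t0 \<in> intervals" "p \<in> coord_simplex t0"
  shows "(\<Sum>t\<in>intervals. a (fst t) (snd t) *\<^sub>R s t) + a (fst t0) (snd t0) *\<^sub>R (p - s t0)
      \<in> Ass_III e n a"
proof -
  have "(\<Sum>t\<in>intervals. a (fst t) (snd t) *\<^sub>R (s(t0 := p)) t)
      = a (fst t0) (snd t0) *\<^sub>R p + (\<Sum>t\<in>intervals - {t0}. a (fst t) (snd t) *\<^sub>R s t)"
    using assms(2) finite_intervals by (subst sum.remove[of _ t0]) auto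
  moreover have "(\<Sum>t\<in>intervals. a (fst t) (snd t) *\<^sub>R s t)
      = a (fst t0) (snd t0) *\<^sub>R s t0 + (\<Sum>t\<in>intervals - {t0}. a (fst t) (snd t) *\<^sub>R s t)"
    using assms(2) finite_intervals by (subst sum.remove[of _ t0]) auto
  moreover have "(\<Sum>t\<in>intervals. a (fst t) (snd t) *\<^sub>R (s(t0 := p)) t) \<in> Ass_III e n a"
    unfolding Ass_III_eq using assms by (intro CollectI exI[of _ "s(t0 := p)"]) auto
  ultimately show ?thesis by (simp add: algebra_simps)
qed

text \<open>
  The vertex \<open>e k\<close> of the simplex of the interval \<open>t\<close> is a maximizer of \<open>w\<close> there.
\<close>

definition best :: "real ^ 'm \<Rightarrow> nat \<times> nat \<Rightarrow> nat \<Rightarrow> bool" where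
  "best w t k \<longleftrightarrow> k \<in> {fst t..snd t} \<and> (\<forall>l\<in>{fst t..snd t}. w \<bullet> e l \<le> w \<bullet> e k)"

lemma best_choice:
  obtains c where "\<forall>t\<in>intervals. best w t (c t)"
proof -
  have "\<exists>k. best w t k" if "t \<in> intervals" for t
  proof -
    let ?W = "(\<lambda>l. w \<bullet> e l) ` {fst t..snd t}"
    have W: "?W \<noteq> {}" "finite ?W"
      using that by (auto simp: intervals_def)
    then have "Max ?W \<in> ?W"
      by (intro Max_in)
    then obtain k where k: "k \<in> {fst t..snd t}" "w \<bullet> e k = Max ?W"
      by force
    then show ?thesis
      using Max_ge[OF W(2)] by (auto simp: best_def)
  qed
  then show ?thesis
    using that bchoice[of intervals "best w"] by blast
qed

end

locale weighted_intervals = numbered_basis n e for n and e :: "nat \<Rightarrow> real ^ 'm" +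
  fixes a :: "nat \<Rightarrow> nat \<Rightarrow> real"
  assumes a_pos: "1 \<le> i \<Longrightarrow> i \<le> j \<Longrightarrow> j \<le> n + 1 \<Longrightarrow> a i j > 0"
begin

lemma weight_pos: "t \<in> intervals \<Longrightarrow> a (fst t) (snd t) > 0"
  by (auto simp: intervals_def a_pos)

lemma best_vertices_maximizer:
  assumes "\<forall>t\<in>intervals. best w t (c t)"
  shows "(\<Sum>t\<in>intervals. a (fst t) (snd t) *\<^sub>R e (c t)) \<in> maximizers w (Ass_III e n a)"
proof -
  have "w \<bullet> y \<le> w \<bullet> (\<Sum>t\<in>intervals. a (fst t) (snd t) *\<^sub>R e (c t))" if y: "y \<in> Ass_III e n a" for y
  proof -
    obtain s where s: "y = (\<Sum>t\<in>intervals. a (fst t) (snd t) *\<^sub>R s t)" "\<forall>t\<in>intervals. s t \<in> coord_simplex t"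
      by (rule Ass_III_memE[OF y])
    have "w \<bullet> s t \<le> w \<bullet> e (c t)" if "t \<in> intervals" for t
      by (rule coord_simplex_inner_le[of _ t]) (use that s(2) assms in \<open>auto simp: best_def\<close>)
    then show ?thesis
      unfolding s(1) inner_sum_right inner_scaleR_right
      by (intro sum_mono mult_left_mono) (auto simp: weight_pos less_imp_le)
  qed
  moreover have "(\<Sum>t\<in>intervals. a (fst t) (snd t) *\<^sub>R e (c t)) \<in> Ass_III e n a"
    unfolding Ass_III_eq using assms
    by (intro CollectI exI[of _ "\<lambda>t. e (c t)"]) (auto simp: best_def e_in_coord_simplex)
  ultimately show ?thesis by (simp add: maximizers_def)
qed

lemma Ass_III_maximizers_nonempty: "maximizers w (Ass_III e n a) \<noteq> {}"
  by (rule best_choice[of w]) (use best_vertices_maximizer in blast)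

text \<open>
  Vertices of the sum may be chosen independently in all summands. A vertex that is maximal for \<open>w\<close>
  with \<open>e k\<close> chosen in the simplex of \<open>t0\<close> is also maximal for \<open>w'\<close>, so moving it to any other vertex
  of that simplex cannot increase \<open>w'\<close>.
\<close>

lemma best_mono:
  assumes "maximizers w (Ass_III e n a) \<subseteq> maximizers w' (Ass_III e n a)"
    and t0: "t0 \<in> intervals" and k: "best w t0 k"
  shows "best w' t0 k"
  unfolding best_def
proof (intro conjI ballI)
  fix l assume l: "l \<in> {fst t0..snd t0}"
  obtain c0 where "\<forall>t\<in>intervals. best w t (c0 t)"
    by (rule best_choice)
  define c where "c = c0(t0 := k)"
  have c: "\<forall>t\<in>intervals. best w t (c t)" "c t0 = k"
    using \<open>\<forall>t\<in>intervals. best w t (c0 t)\<close> k by (auto simp: c_def)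
  let ?y = "\<Sum>t\<in>intervals. a (fst t) (snd t) *\<^sub>R e (c t)"
  have "?y + a (fst t0) (snd t0) *\<^sub>R (e l - e (c t0)) \<in> Ass_III e n a"
    using c t0 l by (intro Ass_III_move[where s = "\<lambda>t. e (c t)"]) (auto simp: best_def e_in_coord_simplex)
  moreover have "?y \<in> maximizers w' (Ass_III e n a)"
    using best_vertices_maximizer[OF c(1)] assms(1) by blast
  ultimately have "w' \<bullet> (?y + a (fst t0) (snd t0) *\<^sub>R (e l - e k)) \<le> w' \<bullet> ?y"
    unfolding maximizers_def using c(2) by auto
  then have "a (fst t0) (snd t0) * (w' \<bullet> e l - w' \<bullet> e k) \<le> 0"
    by (simp add: inner_add_right inner_diff_right)
  then show "w' \<bullet> e l \<le> w' \<bullet> e k"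
    using weight_pos[OF t0] by (simp add: mult_le_0_iff)
qed (use k in \<open>simp add: best_def\<close>)

text \<open>
  The extreme faces of \<open>initial i\<close> are facets. On \<open>{1..i}\<close> and on \<open>{i + 1..n + 1}\<close> the functional
  \<open>initial i\<close> does not distinguish the vertices, so by the previous lemma neither does \<open>w\<close>; hence \<open>w\<close>
  has at most two distinct coordinates. The full interval \<open>{1..n + 1}\<close> determines which of them is
  larger.
\<close>

lemma initial_face_rigid:
  assumes i: "i \<in> {1..n}" and s: "s = 1 \<or> s = - 1"
    and sub: "maximizers (s *\<^sub>R initial i) (Ass_III e n a) \<subseteq> maximizers w (Ass_III e n a)"
  obtains t d where "t \<ge> 0" "w = (t * s) *\<^sub>R initial i + d *\<^sub>R ones"
proof -
  have init: "initial i \<bullet> e l = (if l \<le> i then 1 else 0)" if "l \<in> {1..n + 1}" for l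
    using that i by (simp add: initial_inner_e)
  have best: "best w (p, q) k"
    if "1 \<le> p" "q \<le> n + 1" "k \<in> {p..q}" "\<forall>l\<in>{p..q}. s * (initial i \<bullet> e l) \<le> s * (initial i \<bullet> e k)"
    for p q k
    using that by (intro best_mono[OF sub]) (auto simp: intervals_def best_def)
  have low: "w \<bullet> e k = w \<bullet> e 1" if "k \<in> {1..i}" for k
    using best[of 1 i k] best[of 1 i 1] that i by (auto simp: init best_def intro!: antisym)
  have high: "w \<bullet> e k = w \<bullet> e (n + 1)" if "k \<in> {i + 1..n + 1}" for k
    using best[of "i + 1" "n + 1" k] best[of "i + 1" "n + 1" "n + 1"] that i
    by (auto simp: init best_def intro!: antisym)
  have sign: "s * (w \<bullet> e 1 - w \<bullet> e (n + 1)) \<ge> 0"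
    using best[of 1 "n + 1" 1] best[of 1 "n + 1" "n + 1"] i s by (auto simp: init best_def)
  have "w = (w \<bullet> e 1 - w \<bullet> e (n + 1)) *\<^sub>R initial i + (w \<bullet> e (n + 1)) *\<^sub>R ones"
  proof (rule e_eqI)
    fix k assume k: "k \<in> {1..n + 1}"
    then show "w \<bullet> e k = ((w \<bullet> e 1 - w \<bullet> e (n + 1)) *\<^sub>R initial i + (w \<bullet> e (n + 1)) *\<^sub>R ones) \<bullet> e k"
      using i low[of k] high[of k] by (auto simp: inner_add_left initial_inner_e ones_inner_e)
  qed
  then show ?thesis
    using that[OF sign, of "w \<bullet> e (n + 1)"] s by (auto simp: mult.assoc mult.commute)
qed

text \<open>
  In the summand of the full interval, a common point would have \<open>initial j\<close> at least 1 and
  \<open>initial i\<close> at most 0, but \<open>initial j\<close> nowhere exceeds \<open>initial i\<close> on this simplex.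
\<close>

lemma initial_faces_disjoint:
  assumes "1 \<le> j" "j \<le> i" "i \<le> n"
  shows "maximizers (initial j) (Ass_III e n a) \<inter> maximizers (- initial i) (Ass_III e n a) = {}"
proof (rule ccontr)
  let ?Q = "Ass_III e n a" and ?t = "(1, n + 1)"
  assume "maximizers (initial j) ?Q \<inter> maximizers (- initial i) ?Q \<noteq> {}"
  then obtain y where y: "y \<in> ?Q" "\<And>y'. y' \<in> ?Q \<Longrightarrow> initial j \<bullet> y' \<le> initial j \<bullet> y"
      "\<And>y'. y' \<in> ?Q \<Longrightarrow> initial i \<bullet> y \<le> initial i \<bullet> y'"
    by (auto simp: maximizers_def)
  obtain s where s: "y = (\<Sum>t\<in>intervals. a (fst t) (snd t) *\<^sub>R s t)" "\<forall>t\<in>intervals. s t \<in> coord_simplex t"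
    by (rule Ass_III_memE[OF y(1)])
  have t: "?t \<in> intervals" by (simp add: intervals_def)
  have move: "y + a 1 (n + 1) *\<^sub>R (e k - s ?t) \<in> ?Q" if "k \<in> {1..n + 1}" for k
    using Ass_III_move[OF s(2) t e_in_coord_simplex[of k ?t], where a = a] that s(1) by simp
  have pos: "a 1 (n + 1) > 0" by (simp add: a_pos)
  have "initial j \<bullet> e 1 \<le> initial j \<bullet> s ?t"
    using y(2)[OF move[of 1]] pos by (auto simp: inner_add_right inner_diff_right mult_le_0_iff)
  moreover have "initial i \<bullet> s ?t \<le> initial i \<bullet> e (n + 1)"
    using y(3)[OF move[of "n + 1"]] pos
    by (auto simp: inner_add_right inner_diff_right zero_le_mult_iff)
  moreover have "(initial j - initial i) \<bullet> s ?t \<le> 0"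
  proof (rule coord_simplex_inner_le)
    show "s ?t \<in> coord_simplex ?t" using s(2) t by blast
    show "(initial j - initial i) \<bullet> e k \<le> 0" if "k \<in> {fst ?t..snd ?t}" for k
      using that assms by (simp add: inner_diff_left initial_inner_e)
  qed
  ultimately show False
    using assms by (simp add: initial_inner_e inner_diff_left)
qed

lemma ones_inner_Ass_III:
  assumes "y \<in> Ass_III e n a"
  shows "ones \<bullet> y = (\<Sum>t\<in>intervals. a (fst t) (snd t))"
proof -
  obtain s where s: "y = (\<Sum>t\<in>intervals. a (fst t) (snd t) *\<^sub>R s t)" "\<forall>t\<in>intervals. s t \<in> coord_simplex t"
    by (rule Ass_III_memE[OF assms])
  have "ones \<bullet> s t = 1" if "t \<in> intervals" for t
  proof (rule antisym)
    have e: "ones \<bullet> e k = 1" if "k \<in> {fst t..snd t}" for k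
      using that \<open>t \<in> intervals\<close> by (intro ones_inner_e) (auto simp: intervals_def)
    show "ones \<bullet> s t \<le> 1"
      by (rule coord_simplex_inner_le[of _ t]) (use s(2) that e in auto)
    have "(- ones) \<bullet> s t \<le> - 1"
      by (rule coord_simplex_inner_le[of _ t]) (use s(2) that e in auto)
    then show "1 \<le> ones \<bullet> s t" by simp
  qed
  then show ?thesis
    unfolding s(1) inner_sum_right by (intro sum.cong) auto
qed

text \<open>
  Moving only the summand of the full interval through its vertices yields \<open>n + 1\<close> points of the
  polytope in which every other point of its affine hull has explicit affine coordinates.
\<close>

lemma Ass_III_affine_frame:
  obtains b z where "b > 0" "\<forall>k\<in>{1..n + 1}. z + b *\<^sub>R e k \<in> Ass_III e n a"
    "\<forall>y\<in>Ass_III e n a. ones \<bullet> (y - z) = b"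
proof -
  define b y0 where "b = a 1 (n + 1)" and "y0 = (\<Sum>t\<in>intervals. a (fst t) (snd t) *\<^sub>R e (fst t))"
  have s: "\<forall>t\<in>intervals. e (fst t) \<in> coord_simplex t"
    by (auto simp: intervals_def e_in_coord_simplex)
  have full: "(1, n + 1) \<in> intervals"
    by (simp add: intervals_def)
  have mem: "(y0 - b *\<^sub>R e 1) + b *\<^sub>R e k \<in> Ass_III e n a" if "k \<in> {1..n + 1}" for k
  proof -
    have "e k \<in> coord_simplex (1, n + 1)"
      using that by (simp add: e_in_coord_simplex)
    from Ass_III_move[OF s full this, of a] show ?thesis
      unfolding fst_conv snd_conv b_def[symmetric] y0_def[symmetric]
      by (simp add: algebra_simps)
  qed
  have "ones \<bullet> (y - (y0 - b *\<^sub>R e 1)) = b" if "y \<in> Ass_III e n a" for y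
    using ones_inner_Ass_III[OF that] ones_inner_Ass_III[OF mem[of 1]] ones_inner_e[of 1]
    by (simp add: inner_diff_right)
  moreover have "b > 0"
    unfolding b_def by (rule a_pos) auto
  ultimately show ?thesis
    using that[of b "y0 - b *\<^sub>R e 1"] mem by blast
qed

end

context numbered_basis
begin

section \<open>Transport along an affine equivalence\<close>

text \<open>
  The inverse of the equivalence is determined by the preimages \<open>x k\<close> of the points
  \<open>z + b *\<^sub>R e k\<close>. Both polytopes lie in hyperplanes orthogonal to \<open>ones\<close>, and that of \<open>P\<close> passes
  through the origin; shifting the preimages by \<open>ones\<close> moves it off the origin, and then the affine
  map between the hyperplanes extends to a linear automorphism of the whole space. The last property
  says that this automorphism is compatible with the direction \<open>ones\<close>.
\<close>

lemma affine_equivalence_linear: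
  assumes equiv: "affinely_equivalent P Q" and P: "P \<subseteq> sum_zero_space e n"
    and b: "b > 0" and frame: "\<forall>k\<in>{1..n + 1}. z + b *\<^sub>R e k \<in> Q"
    and plane: "\<forall>y\<in>Q. ones \<bullet> (y - z) = b"
  obtains M :: "real ^ 'm \<Rightarrow> real ^ 'm" and c r where "linear M" "inj M" "P = (\<lambda>y. M y + c) ` Q"
    "r \<noteq> 0" "\<forall>v. ones \<bullet> M v = r * (ones \<bullet> v)"
proof -
  let ?A = "affine hull P" and ?I = "{1..n + 1}"
  obtain f where f: "affine_map_on ?A f" "inj_on f ?A" "f ` P = Q"
    using equiv by (auto simp: affinely_equivalent_def bij_betw_def)
  have "\<forall>k\<in>?I. \<exists>x. x \<in> P \<and> f x = z + b *\<^sub>R e k"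
    using frame f(3) by (metis (no_types, lifting) image_iff)
  then obtain x where x: "\<forall>k\<in>?I. x k \<in> P \<and> f (x k) = z + b *\<^sub>R e k"
    using bchoice[of ?I "\<lambda>k x. x \<in> P \<and> f x = z + b *\<^sub>R e k"] by blast
  define M where "M v = (\<Sum>k\<in>?I. ((v \<bullet> e k) / b) *\<^sub>R (x k + ones))" for v
  define r where "r = (ones \<bullet> ones) / b"
  have sum_inner: "(\<Sum>k\<in>?I. v \<bullet> e k) = ones \<bullet> v" for v
    by (subst inner_commute) (simp add: ones_def initial_def inner_sum_right del: One_nat_def sum.cl_ivl_Suc)
  have "linear M"
    unfolding M_def
    by (intro linearI) (simp_all add: inner_add_left add_divide_distrib scaleR_add_left sum.distrib
        scaleR_sum_right del: One_nat_def sum.cl_ivl_Suc)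
  have ones_x: "ones \<bullet> (x k + ones) = ones \<bullet> ones" if "k \<in> ?I" for k
  proof -
    have "x k \<in> sum_zero_space e n" using x P that by blast
    then show ?thesis by (simp add: inner_add_right sum_zero_space_iff inner_commute)
  qed
  have M_ones: "ones \<bullet> M v = r * (ones \<bullet> v)" for v
  proof -
    have "ones \<bullet> M v = (\<Sum>k\<in>?I. r * (v \<bullet> e k))"
      unfolding M_def inner_sum_right r_def using ones_x by (intro sum.cong) auto
    then show ?thesis unfolding sum_distrib_left[symmetric] sum_inner .
  qed
  have "ones \<noteq> 0" using ones_inner_e[of 1] by auto
  then have "r \<noteq> 0" using b by (simp add: r_def)
  have f_M: "M v - ones \<in> ?A \<and> f (M v - ones) = z + v" if "ones \<bullet> v = b" for v
  proof -
    have coeffs: "(\<Sum>k\<in>?I. (v \<bullet> e k) / b) = 1"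
      using that b sum_inner[of v] by (simp flip: sum_divide_distrib del: One_nat_def sum.cl_ivl_Suc)
    have "M v - ones = (\<Sum>k\<in>?I. ((v \<bullet> e k) / b) *\<^sub>R x k)"
      unfolding M_def scaleR_add_right sum.distrib using coeffs
      by (simp flip: scaleR_left.sum del: One_nat_def sum.cl_ivl_Suc)
    moreover have "x k \<in> ?A" if "k \<in> ?I" for k
      using x that by (auto simp: hull_inc)
    moreover have "(\<Sum>k\<in>?I. ((v \<bullet> e k) / b) *\<^sub>R f (x k)) = z + v"
    proof -
      have "(\<Sum>k\<in>?I. ((v \<bullet> e k) / b) *\<^sub>R f (x k))
          = (\<Sum>k\<in>?I. ((v \<bullet> e k) / b) *\<^sub>R z + (v \<bullet> e k) *\<^sub>R e k)"
        using x b by (intro sum.cong) (auto simp: scaleR_add_right)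
      also have "\<dots> = z + v"
        unfolding sum.distrib e_expansion using coeffs
        by (simp flip: scaleR_left.sum del: One_nat_def sum.cl_ivl_Suc)
      finally show ?thesis .
    qed
    ultimately show ?thesis
      using affine_map_on_combination[OF f(1) affine_affine_hull, of ?I "\<lambda>k. (v \<bullet> e k) / b" x] coeffs
      by (simp del: One_nat_def sum.cl_ivl_Suc)
  qed
  have "inj M"
    unfolding linear_injective_0[OF \<open>linear M\<close>]
  proof (intro allI impI)
    fix v assume "M v = 0"
    then have "ones \<bullet> v = 0" using M_ones[of v] \<open>r \<noteq> 0\<close> by simp
    moreover have "ones \<bullet> (b *\<^sub>R e 1) = b" using ones_inner_e[of 1] by simp
    moreover have "M (b *\<^sub>R e 1 + v) = M (b *\<^sub>R e 1)"
      using \<open>M v = 0\<close> \<open>linear M\<close> by (simp add: linear_add)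
    \<comment> \<open>Two points of the hyperplane \<open>ones \<bullet> v = b\<close> with the same image have the same value under \<open>f\<close>.\<close>
    ultimately show "v = 0"
      using f_M[of "b *\<^sub>R e 1"] f_M[of "b *\<^sub>R e 1 + v"] by (simp add: inner_add_right)
  qed
  have inv: "M (f p - z) - ones = p" if "p \<in> P" for p
  proof -
    have "ones \<bullet> (f p - z) = b" using plane f(3) that by blast
    moreover have "p \<in> ?A" using that by (simp add: hull_inc)
    ultimately show ?thesis using f_M[of "f p - z"] f(2) by (auto simp: inj_on_def)
  qed
  have "P = (\<lambda>y. M (y - z) - ones) ` f ` P"
    unfolding image_image using inv by force
  then have "P = (\<lambda>y. M y + (- M z - ones)) ` Q"
    unfolding f(3) using linear_diff[OF \<open>linear M\<close>] by (simp add: algebra_simps)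
  then show ?thesis using that \<open>linear M\<close> \<open>inj M\<close> \<open>r \<noteq> 0\<close> M_ones by blast
qed

end

text \<open>
  The consequence of an affine equivalence that the rest of the proof uses. The assumptions turn out
  to be contradictory for \<open>n \<ge> 3\<close>.
\<close>

locale linear_realization = weighted_intervals n e a for n and e :: "nat \<Rightarrow> real ^ 'm" and a +
  fixes P :: "(real ^ 'm) set" and M :: "real ^ 'm \<Rightarrow> real ^ 'm" and c :: "real ^ 'm" and r :: real
  assumes ass: "is_Ass_II e n P"
    and M: "linear M" "inj M"
    and P_eq: "P = (\<lambda>y. M y + c) ` Ass_III e n a"
    and r: "r \<noteq> 0" "\<And>v. ones \<bullet> M v = r * (ones \<bullet> v)"
begin

abbreviation "Q \<equiv> Ass_III e n a"
abbreviation "N \<equiv> adjoint M"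

lemma inner_N: "N u \<bullet> v = u \<bullet> M v"
  using adjoint_works[OF M(1), of v u] by (simp add: inner_commute)

lemma N_linear: "linear N"
  by (rule adjoint_linear[OF M(1)])

lemma N_inj: "inj N"
  unfolding linear_injective_0[OF N_linear]
proof (intro allI impI)
  fix u assume "N u = 0"
  obtain v where "u = M v"
    using linear_injective_imp_surjective[OF M] by (auto simp: surj_def)
  then show "u = 0"
    using inner_N[of u v] \<open>N u = 0\<close> by simp
qed

lemma N_ones: "N ones = r *\<^sub>R ones"
  by (rule vector_eq_rdot[THEN iffD1]) (simp add: inner_N r(2))

lemma mem_maximizers_P: "M y + c \<in> maximizers u P \<longleftrightarrow> y \<in> maximizers (N u) Q"
  if "y \<in> Q"
  using that by (auto simp: maximizers_def P_eq inner_N inner_add_right)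

text \<open>
  The functional \<open>ones\<close> is constant on \<open>Q\<close>.
\<close>

lemma maximizers_normalise:
  assumes "t > 0"
  shows "maximizers (t *\<^sub>R w + d *\<^sub>R ones) Q = maximizers w Q"
proof -
  have "(t *\<^sub>R w + d *\<^sub>R ones) \<bullet> y \<le> (t *\<^sub>R w + d *\<^sub>R ones) \<bullet> x \<longleftrightarrow> w \<bullet> y \<le> w \<bullet> x"
    if "x \<in> Q" "y \<in> Q" for x y
    using assms ones_inner_Ass_III[OF that(1)] ones_inner_Ass_III[OF that(2)]
    by (simp add: inner_add_left)
  then show ?thesis by (auto simp: maximizers_def)
qed

lemma N_multiple_ones:
  assumes "u \<in> sum_zero_space e n" "N u = d *\<^sub>R ones"
  shows "u = 0"
proof -
  have "N u = N ((d / r) *\<^sub>R ones)"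
    using assms(2) r(1) by (simp add: linear_scale[OF N_linear] N_ones)
  then have u: "u = (d / r) *\<^sub>R ones"
    using N_inj by (auto simp: inj_def)
  have "u \<bullet> u = 0"
    using assms(1) by (subst (2) u) (simp add: sum_zero_space_iff)
  then show ?thesis by simp
qed

text \<open>
  Every functional on \<open>Q\<close> is the pullback of one given by a vector in the space of the roots.
\<close>

lemma N_lift:
  obtains u d where "u \<in> sum_zero_space e n" "N u = w + d *\<^sub>R ones"
proof -
  obtain v where v: "w = N v"
    using linear_injective_imp_surjective[OF N_linear N_inj] by (auto simp: surj_def)
  define d where "d = - (v \<bullet> ones) / (ones \<bullet> ones)"
  have "ones \<noteq> 0" using ones_inner_e[of 1] by auto
  then have "v + d *\<^sub>R ones \<in> sum_zero_space e n"
    by (simp only: sum_zero_space_iff inner_add_left d_def inner_scaleR_left) simp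
  moreover have "N (v + d *\<^sub>R ones) = w + (d * r) *\<^sub>R ones"
    by (simp add: v linear_add[OF N_linear] linear_scale[OF N_linear] N_ones)
  ultimately show ?thesis by (rule that)
qed

lemma initial_not_multiple_ones:
  assumes "i \<in> {1..n}" "t \<noteq> 0"
  shows "t *\<^sub>R initial i \<noteq> d *\<^sub>R ones"
proof
  assume "t *\<^sub>R initial i = d *\<^sub>R ones"
  then have "t * (initial i \<bullet> e k) = d * (ones \<bullet> e k)" for k
    by (metis inner_scaleR_left)
  from this[of 1] this[of "n + 1"] show False
    using assms by (simp add: initial_inner_e ones_inner_e)
qed

text \<open>
  Lift \<open>s *\<^sub>R initial i\<close> to a vector \<open>u\<close>. The root that is maximal wherever \<open>u\<close> is pulls back to a
  functional that is maximal along an extreme face of \<open>initial i\<close>, and that face is rigid. The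
  multiple is nonzero because no root gives a constant functional on \<open>P\<close>.
\<close>

lemma root_of_initial:
  assumes i: "i \<in> {1..n}" and s: "s = 1 \<or> s = - 1"
  obtains \<beta> t d where "\<beta> \<in> almost_positive_roots e n" "t > 0"
    "N \<beta> = (t * s) *\<^sub>R initial i + d *\<^sub>R ones"
proof -
  obtain u d where u: "u \<in> sum_zero_space e n" "N u = s *\<^sub>R initial i + d *\<^sub>R ones"
    by (rule N_lift)
  have max_u: "maximizers (N u) Q = maximizers (s *\<^sub>R initial i) Q"
    using maximizers_normalise[of 1 "s *\<^sub>R initial i" d] u(2) by simp
  have "u \<noteq> 0"
  proof
    assume "u = 0"
    then have "s *\<^sub>R initial i = (- d) *\<^sub>R ones"
      using u(2) linear_0[OF N_linear] by (simp add: add_eq_0_iff2)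
    moreover have "s \<noteq> 0" using s by auto
    ultimately show False using initial_not_multiple_ones[OF i] by blast
  qed
  moreover have "maximizers u P \<noteq> {}"
  proof -
    obtain y where "y \<in> maximizers (N u) Q"
      using Ass_III_maximizers_nonempty by blast
    then have "M y + c \<in> maximizers u P"
      using mem_maximizers_P by (auto simp: maximizers_def)
    then show ?thesis by blast
  qed
  ultimately obtain \<beta> where \<beta>: "\<beta> \<in> almost_positive_roots e n" "maximizers u P \<subseteq> maximizers \<beta> P"
    using Ass_II_maximizers_subset_root[OF ass u(1)] by blast
  have "maximizers (s *\<^sub>R initial i) Q \<subseteq> maximizers (N \<beta>) Q"
  proof
    fix y assume y: "y \<in> maximizers (s *\<^sub>R initial i) Q"
    then have "y \<in> Q" by (simp add: maximizers_def)
    with y \<beta>(2) show "y \<in> maximizers (N \<beta>) Q"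
      unfolding max_u[symmetric] using mem_maximizers_P by blast
  qed
  then obtain t d' where t: "t \<ge> 0" "N \<beta> = (t * s) *\<^sub>R initial i + d' *\<^sub>R ones"
    by (rule initial_face_rigid[OF i s])
  moreover have "t \<noteq> 0"
  proof
    assume "t = 0"
    then have "N \<beta> = d' *\<^sub>R ones" using t(2) by simp
    then show False
      using N_multiple_ones almost_positive_root_sum_zero[OF \<beta>(1)] by blast
  qed
  ultimately show ?thesis using that[OF \<beta>(1), of t d'] by simp
qed

text \<open>
  The roots found for the two opposite faces pull back to functionals whose suitable positive
  combination is constant on \<open>Q\<close>, so the same combination of the roots vanishes.
\<close>

lemma initial_is_simple_root:
  assumes i: "i \<in> {1..n}"
  obtains k t d where "k \<in> {1..n}" "t \<noteq> 0" "N (simple_root e k) = t *\<^sub>R initial i + d *\<^sub>R ones"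
proof -
  obtain \<beta> t d where \<beta>: "\<beta> \<in> almost_positive_roots e n" "t > 0"
      "N \<beta> = (t * 1) *\<^sub>R initial i + d *\<^sub>R ones"
    by (rule root_of_initial[OF i, of 1]) auto
  obtain \<gamma> t' d' where \<gamma>: "\<gamma> \<in> almost_positive_roots e n" "t' > 0"
      "N \<gamma> = (t' * - 1) *\<^sub>R initial i + d' *\<^sub>R ones"
    by (rule root_of_initial[OF i, of "- 1"]) auto
  have "N (t' *\<^sub>R \<beta> + t *\<^sub>R \<gamma>) = (t' * d + t * d') *\<^sub>R ones"
    by (simp add: linear_add[OF N_linear] linear_scale[OF N_linear] \<beta>(3) \<gamma>(3) algebra_simps)
  moreover have "t' *\<^sub>R \<beta> + t *\<^sub>R \<gamma> \<in> sum_zero_space e n"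
    using almost_positive_root_sum_zero(1) \<beta>(1) \<gamma>(1) by (simp add: sum_zero_space_iff inner_add_left)
  ultimately have "t' *\<^sub>R \<beta> + t *\<^sub>R \<gamma> = 0"
    by (intro N_multiple_ones)
  then obtain k where k: "k \<in> {1..n}" "\<beta> = simple_root e k \<or> \<beta> = - simple_root e k"
    using opposite_roots[OF \<beta>(1) \<gamma>(1) \<gamma>(2) \<beta>(2)] by blast
  from k(2) show ?thesis
  proof
    assume "\<beta> = simple_root e k"
    then show ?thesis using that[OF k(1), of t d] \<beta>(2,3) by simp
  next
    assume "\<beta> = - simple_root e k"
    then have "N (simple_root e k) = - N \<beta>"
      by (simp add: linear_neg[OF N_linear])
    then show ?thesis using that[OF k(1), of "- t" "- d"] \<beta>(2,3) by simp
  qed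
qed

text \<open>
  The signs of \<open>p\<close> and \<open>q\<close> are absorbed into the signs of the simple roots, all of which are allowed.
\<close>

lemma distant_simple_roots_meet:
  assumes "k \<in> {1..n}" "l \<in> {1..n}" "k + 2 \<le> l"
    and k: "p \<noteq> 0" "N (simple_root e k) = p *\<^sub>R v + d *\<^sub>R ones"
    and l: "q \<noteq> 0" "N (simple_root e l) = q *\<^sub>R w + d' *\<^sub>R ones"
  shows "maximizers v Q \<inter> maximizers w Q \<noteq> {}"
proof -
  define \<beta> \<gamma> where "\<beta> = sgn p *\<^sub>R simple_root e k" and "\<gamma> = sgn q *\<^sub>R simple_root e l"
  have "N \<beta> = \<bar>p\<bar> *\<^sub>R v + (sgn p * d) *\<^sub>R ones" "N \<gamma> = \<bar>q\<bar> *\<^sub>R w + (sgn q * d') *\<^sub>R ones"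
    by (simp_all add: \<beta>_def \<gamma>_def linear_scale[OF N_linear] k(2) l(2) scaleR_add_right abs_sgn mult.commute)
  then have max: "maximizers (N \<beta>) Q = maximizers v Q" "maximizers (N \<gamma>) Q = maximizers w Q"
    using k(1) l(1) by (simp_all add: maximizers_normalise)
  have "maximizers \<beta> P \<inter> maximizers \<gamma> P \<noteq> {}"
    using k(1) l(1) by (intro Ass_II_simple_roots_meet[OF ass assms(1-3)]) (auto simp: \<beta>_def \<gamma>_def sgn_if)
  then obtain x where x: "x \<in> maximizers \<beta> P" "x \<in> maximizers \<gamma> P" by blast
  then obtain y where y: "y \<in> Q" "x = M y + c"
    by (auto simp: maximizers_def P_eq)
  then show ?thesis
    using x mem_maximizers_P[OF y(1)] max by blast
qed

text \<open>
  Two simple roots that are not neighbours would give a point at which \<open>initial j\<close> is largest and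
  \<open>initial i\<close> is smallest.
\<close>

lemma initials_from_neighbours:
  assumes ij: "1 \<le> j" "j < i" "i \<le> n"
    and k: "k \<in> {1..n}" "p \<noteq> 0" "N (simple_root e k) = p *\<^sub>R initial i + d *\<^sub>R ones"
    and l: "l \<in> {1..n}" "q \<noteq> 0" "N (simple_root e l) = q *\<^sub>R initial j + d' *\<^sub>R ones"
  shows "k = l + 1 \<or> l = k + 1"
proof -
  have disj: "maximizers (initial j) Q \<inter> maximizers (- initial i) Q = {}"
    using initial_faces_disjoint ij by simp
  have k': "- p \<noteq> 0" "N (simple_root e k) = (- p) *\<^sub>R (- initial i) + d *\<^sub>R ones"
    using k by auto
  have "\<not> k + 2 \<le> l"
    using distant_simple_roots_meet[OF k(1) l(1) _ k' l(2,3)] disj by blast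
  moreover have "\<not> l + 2 \<le> k"
    using distant_simple_roots_meet[OF l(1) k(1) _ l(2,3) k'] disj by blast
  \<comment> \<open>\<open>initial i\<close> and \<open>initial j\<close> differ at the coordinate \<open>i\<close> and agree at \<open>n + 1\<close>.\<close>
  moreover have "k \<noteq> l"
  proof
    assume "k = l"
    then have "p *\<^sub>R initial i + d *\<^sub>R ones = q *\<^sub>R initial j + d' *\<^sub>R ones"
      using k(3) l(3) by simp
    then have *: "p * (initial i \<bullet> e m) + d * (ones \<bullet> e m) = q * (initial j \<bullet> e m) + d' * (ones \<bullet> e m)" for m
      by (metis inner_add_left inner_scaleR_left)
    show False
      using *[of i] *[of "n + 1"] ij \<open>p \<noteq> 0\<close> by (simp add: initial_inner_e ones_inner_e)
  qed
  ultimately show ?thesis by linarith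
qed

text \<open>
  There are no three natural numbers any two of which are consecutive.
\<close>

lemma n_less_3: "n < 3"
proof (rule ccontr)
  assume "\<not> n < 3"
  then have n: "1 \<in> {1..n}" "2 \<in> {1..n}" "3 \<in> {1..n}" by auto
  obtain k1 t1 d1 where 1: "k1 \<in> {1..n}" "t1 \<noteq> 0" "N (simple_root e k1) = t1 *\<^sub>R initial 1 + d1 *\<^sub>R ones"
    by (rule initial_is_simple_root[OF n(1)])
  obtain k2 t2 d2 where 2: "k2 \<in> {1..n}" "t2 \<noteq> 0" "N (simple_root e k2) = t2 *\<^sub>R initial 2 + d2 *\<^sub>R ones"
    by (rule initial_is_simple_root[OF n(2)])
  obtain k3 t3 d3 where 3: "k3 \<in> {1..n}" "t3 \<noteq> 0" "N (simple_root e k3) = t3 *\<^sub>R initial 3 + d3 *\<^sub>R ones"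
    by (rule initial_is_simple_root[OF n(3)])
  have "k2 = k1 + 1 \<or> k1 = k2 + 1"
    by (rule initials_from_neighbours[OF _ _ _ 2 1]) (use n in auto)
  moreover have "k3 = k1 + 1 \<or> k1 = k3 + 1"
    by (rule initials_from_neighbours[OF _ _ _ 3 1]) (use n in auto)
  moreover have "k3 = k2 + 1 \<or> k2 = k3 + 1"
    by (rule initials_from_neighbours[OF _ _ _ 3 2]) (use n in auto)
  ultimately show False by linarith
qed

end

theorem theorem3p2:
  fixes n :: nat
    and e :: "nat \<Rightarrow> real ^ 'm"
    and P :: "(real ^ 'm) set"
    and a :: "nat \<Rightarrow> nat \<Rightarrow> real"
  assumes "n \<ge> 3"
    and "bij_betw e {1..n+1} Basis"
    and "is_Ass_II e n P"
    and "\<And>i j. 1 \<le> i \<Longrightarrow> i \<le> j \<Longrightarrow> j \<le> n + 1 \<Longrightarrow> a i j > 0"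
  shows "\<not> affinely_equivalent P (Ass_III e n a)"
proof
  assume equiv: "affinely_equivalent P (Ass_III e n a)"
  interpret weighted_intervals n e a
    by standard (rule assms(2), rule assms(4))
  obtain b z where frame: "b > 0" "\<forall>k\<in>{1..n + 1}. z + b *\<^sub>R e k \<in> Ass_III e n a"
      "\<forall>y\<in>Ass_III e n a. ones \<bullet> (y - z) = b"
    by (rule Ass_III_affine_frame)
  have P: "P \<subseteq> sum_zero_space e n"
    using assms(3) by (simp add: is_Ass_II_def)
  obtain M :: "real ^ 'm \<Rightarrow> real ^ 'm" and c r where M: "linear M" "inj M"
      "P = (\<lambda>y. M y + c) ` Ass_III e n a" "r \<noteq> 0" "\<forall>v. ones \<bullet> M v = r * (ones \<bullet> v)"
    by (rule affine_equivalence_linear[OF equiv P frame])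
  interpret linear_realization n e a P M c r
    by (intro linear_realization.intro linear_realization_axioms.intro weighted_intervals_axioms)
      (rule assms(3) M(1-4) M(5)[rule_format])+
  show False
    using n_less_3 assms(1) by simp
qed

end
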